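(* Let $\Sigma$ be the operator acting by the plethysm $[X]\mapsto[X/(t-1)]$, so that $\Sigma^{-1}$ acts by $[X]\mapsto[X(t-1)]$. Then the following identities between operators acting on $\mathcal P_+[X]$ hold: $$\mathfrak m_\infty(z)=\frac1{1-t^{-1}}\big(\Sigma^{-1}D(z)\Sigma\big)\Big|_{t\to t^{-1}},\qquad \widetilde{\mathfrak m}_\infty(z)=\frac1{1-t}\Big(\Sigma^{-1}D^*\Big(\frac z{qt}\Big)\Sigma\Big)\Big|_{t\to t^{-1}} .$$
   Context: $q,t$ are indeterminates. $\mathcal P_+$ is the space of formal power series of the algebraically independent variables $p_k$, $k\ge1$, and $\mathcal P_+[X]$ is the space of functions $F[X]$, $F\in\mathcal P_+$, obtained by evaluating $p_k=p_k[X]=\sum_ix_i^k$ on an infinite alphabet $X=(x_1,x_2,\dots)$ (these power sums remain algebraically independent). Plethystic notation: $F[X+A]$ means $p_k\mapsto p_k+p_k[A]$ and $F[\lambda X]$, for $\lambda$ a rational function of $q,t$, means $p_k\mapsto\lambda(q^k,t^k)\,p_k$; in particular $p_k\big[\tfrac{q-1}{z}\big]=\tfrac{q^k-1}{z^k}$, $p_k\big[\tfrac{(1-t)(1-q)}{z}\big]=\tfrac{(1-t^k)(1-q^k)}{z^k}$, $p_k\big[\tfrac{(1-t^{-1})(1-q^{-1})}{z}\big]=\tfrac{(1-t^{-k})(1-q^{-k})}{z^k}$, and $\Sigma:p_k\mapsto p_k/(t^k-1)$, $\Sigma^{-1}:p_k\mapsto(t^k-1)p_k$. The notation $(\cdot)|_{t\to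 t^{-1}}$ means that $t$ is replaced by $t^{-1}$ in the operator written in terms of the $p_k$. Let $C_\infty(z)=\prod_{i\ge1}(1-zx_i)=\exp(-\sum_{k\ge1}p_kz^k/k)$; prefactors below are expanded as power series in $z$. The currents $D(z)=\sum_{k\in\mathbb Z}z^kD_k$, $D^*(z)=\sum_{k\in\mathbb Z}z^kD^*_k$ act by $$D(z)F[X]=C_\infty(z)\,F\Big[X+\frac{(1-t)(1-q)}{z}\Big],\qquad D^*(z)F[X]=\frac1{C_\infty(z)}\,F\Big[X-\frac{(1-t^{-1})(1-q^{-1})}{z}\Big].$$ The currents $\mathfrak m_\infty(z)$, $\widetilde{\mathfrak m}_\infty(z)$ are the infinite-rank limits of generating functions of generalized Macdonald operators: $\mathfrak m_\infty(z)=\lim_{N\to\infty}t^{1-N}\mathfrak m(z)$ with $\mathfrak m(z)=\sum_{n\in\mathbb Z}z^n\sum_{i=1}^Nx_i^n\prod_{j\ne i}\frac{tx_i-x_j}{x_i-x_j}\Gamma_i$ ($\Gamma_i:x_i\mapsto qx_i$, $|t|>1$), and $\widetilde{\mathfrak m}_\infty(z)=\mathfrak m_\infty(qz)|_{q\to q^{-1},t\to t^{-1}}$. They act by $$\mathfrak m_\infty(z)F[X]=\frac1{1-t^{-1}}\frac{C_\infty(t^{-1}z)}{C_\infty(z)}F\Big[X+\frac{q-1}z\Big],\qquad \widetilde{\mathfrak m}_\infty(z)F[X]=\frac1{1-t}\frac{C_\infty(tq^{-1}z)}{C_\infty(q^{-1}z)}F\Big[X-\frac{q-1}z\Big].$$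 *)

theory Defs
  imports
    "HOL-Computational_Algebra.Computational_Algebra"
    "HOL-Library.Multiset"
    "HOL-Library.Groups_Big_Fun"
begin

section \<open>Formal power series in the power sums\<close>

text \<open>
  The index set of the variables \<open>p\<^sub>1, p\<^sub>2, \<dots>\<close> is the library type \<^typ>\<open>num\<close> of strictly
  positive integers, and a monomial \<open>p\<^bsub>k1\<^esub> p\<^bsub>k2\<^esub> \<dots>\<close> is the finite multiset
  \<open>{#k1, k2, \<dots>#}\<close> of its indices, i.e. an integer partition. A power series is its
  (arbitrary) family of coefficients. Since the power sums of an infinite alphabet are
  algebraically independent, the function \<open>F[X]\<close> is identified with the series \<open>F\<close>.
\<close>

typedef 'r pser = "UNIV :: (num multiset \<Rightarrow> 'r) set"
  morphisms ps_nth Abs_pser ..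

lemma ps_nth_Abs [simp]: "ps_nth (Abs_pser f) = f"
  by (simp add: Abs_pser_inverse)

lemma pser_eqI: "(\<And>\<mu>. ps_nth F \<mu> = ps_nth G \<mu>) \<Longrightarrow> F = G"
  by (metis ext ps_nth_inject)

lemma finite_submultisets: "finite {\<alpha>. \<alpha> \<subseteq># \<mu>}"
proof (induction \<mu>)
  case empty
  then show ?case by simp
next
  case (add x \<mu>)
  have "{\<alpha>. \<alpha> \<subseteq># add_mset x \<mu>} \<subseteq> {\<alpha>. \<alpha> \<subseteq># \<mu>} \<union> add_mset x ` {\<alpha>. \<alpha> \<subseteq># \<mu>}"
  proof
    fix \<alpha> assume "\<alpha> \<in> {\<alpha>. \<alpha> \<subseteq># add_mset x \<mu>}"
    then have a: "\<alpha> \<subseteq># add_mset x \<mu>" by simp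
    show "\<alpha> \<in> {\<alpha>. \<alpha> \<subseteq># \<mu>} \<union> add_mset x ` {\<alpha>. \<alpha> \<subseteq># \<mu>}"
    proof (cases "x \<in># \<alpha>")
      case True
      then obtain \<beta> where "\<alpha> = add_mset x \<beta>" by (metis mset_add)
      then show ?thesis using a by auto
    next
      case False
      then show ?thesis
        using a by (metis UnI1 diff_single_trivial mem_Collect_eq subset_eq_diff_conv
            add_mset_add_single)
    qed
  qed
  then show ?case using add by (auto intro: finite_subset)
qed

instantiation pser :: (comm_ring_1) comm_ring_1
begin

definition "0 = Abs_pser (\<lambda>_. 0)"
definition "1 = Abs_pser (\<lambda>\<mu>. if \<mu> = {#} then 1 else 0)"
definition "F + G = Abs_pser (\<lambda>\<mu>. ps_nth F \<mu> + ps_nth G \<mu>)"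
definition "F - G = Abs_pser (\<lambda>\<mu>. ps_nth F \<mu> - ps_nth G \<mu>)"
definition "- F = Abs_pser (\<lambda>\<mu>. - ps_nth F \<mu>)"
definition "F * G = Abs_pser (\<lambda>\<mu>. \<Sum>\<alpha> | \<alpha> \<subseteq># \<mu>. ps_nth F \<alpha> * ps_nth G (\<mu> - \<alpha>))"

instance
proof
  fix F G H :: "'a pser"
  show "F + G + H = F + (G + H)"
    by (rule pser_eqI) (simp add: plus_pser_def add.assoc)
  show "F + G = G + F"
    by (rule pser_eqI) (simp add: plus_pser_def add.commute)
  show "0 + F = F"
    by (rule pser_eqI) (simp add: plus_pser_def zero_pser_def)
  show "- F + F = 0"
    by (rule pser_eqI) (simp add: plus_pser_def zero_pser_def uminus_pser_def)
  show "F - G = F + - G"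
    by (rule pser_eqI) (simp add: plus_pser_def minus_pser_def uminus_pser_def)
  show "(F + G) * H = F * H + G * H"
    by (rule pser_eqI) (simp add: plus_pser_def times_pser_def distrib_right sum.distrib)
  show "(0::'a pser) \<noteq> 1"
  proof
    assume "(0::'a pser) = 1"
    then have "ps_nth (0::'a pser) {#} = ps_nth 1 {#}" by simp
    then show False by (simp add: zero_pser_def one_pser_def)
  qed
  show "F * G = G * F"
  proof (rule pser_eqI)
    fix \<mu>
    have "(\<Sum>\<alpha> | \<alpha> \<subseteq># \<mu>. ps_nth F \<alpha> * ps_nth G (\<mu> - \<alpha>)) =
        (\<Sum>\<alpha> | \<alpha> \<subseteq># \<mu>. ps_nth G \<alpha> * ps_nth F (\<mu> - \<alpha>))"
      by (rule sum.reindex_bij_witness[of _ "\<lambda>\<alpha>. \<mu> - \<alpha>" "\<lambda>\<alpha>. \<mu> - \<alpha>"])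
        (auto simp: mult.commute mset_subset_eq_exists_conv)
    then show "ps_nth (F * G) \<mu> = ps_nth (G * F) \<mu>" by (simp add: times_pser_def)
  qed
  show "1 * F = F"
  proof (rule pser_eqI)
    fix \<mu>
    have "(\<Sum>\<alpha> | \<alpha> \<subseteq># \<mu>. (if \<alpha> = {#} then 1 else 0) * ps_nth F (\<mu> - \<alpha>)) =
        (\<Sum>\<alpha> | \<alpha> \<subseteq># \<mu>. if \<alpha> = {#} then ps_nth F \<mu> else 0)"
      by (rule sum.cong) auto
    then show "ps_nth (1 * F) \<mu> = ps_nth F \<mu>"
      by (simp add: times_pser_def one_pser_def sum.delta finite_submultisets)
  qed
  show "F * G * H = F * (G * H)"
  proof (rule pser_eqI)
    fix \<mu>
    have "ps_nth (F * G * H) \<mu> =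
        (\<Sum>(\<beta>, \<alpha>) \<in> (SIGMA \<beta>:{\<beta>. \<beta> \<subseteq># \<mu>}. {\<alpha>. \<alpha> \<subseteq># \<beta>}).
          ps_nth F \<alpha> * ps_nth G (\<beta> - \<alpha>) * ps_nth H (\<mu> - \<beta>))"
      by (simp add: times_pser_def sum_distrib_right sum.Sigma finite_submultisets)
    also have "\<dots> =
        (\<Sum>(\<alpha>, \<gamma>) \<in> (SIGMA \<alpha>:{\<alpha>. \<alpha> \<subseteq># \<mu>}. {\<gamma>. \<gamma> \<subseteq># \<mu> - \<alpha>}).
          ps_nth F \<alpha> * (ps_nth G \<gamma> * ps_nth H (\<mu> - \<alpha> - \<gamma>)))"
    proof (rule sum.reindex_bij_witness[of _ "\<lambda>(\<alpha>, \<gamma>). (\<alpha> + \<gamma>, \<alpha>)" "\<lambda>(\<beta>, \<alpha>). (\<alpha>, \<beta> - \<alpha>)"],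
        goal_cases)
      case (1 a)
      then show ?case by auto
    next
      case (2 a)
      then show ?case by (auto simp: mset_subset_eq_exists_conv add.assoc)
    next
      case (3 b)
      then show ?case by auto
    next
      case (4 b)
      then show ?case
        by (force simp: mset_subset_eq_exists_conv add.assoc)
    next
      case (5 a)
      then show ?case
        by (auto simp: mset_subset_eq_exists_conv mult.assoc)
    qed
    also have "\<dots> = ps_nth (F * (G * H)) \<mu>"
      by (simp add: times_pser_def sum_distrib_left sum.Sigma finite_submultisets)
    finally show "ps_nth (F * G * H) \<mu> = ps_nth (F * (G * H)) \<mu>" .
  qed
qed

end

definition ps_const :: "'r \<Rightarrow> 'r::comm_ring_1 pser" where
  "ps_const c = Abs_pser (\<lambda>\<mu>. if \<mu> = {#} then c else 0)"

definition ps_var :: "num \<Rightarrow> 'r::comm_ring_1 pser" where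
  "ps_var k = Abs_pser (\<lambda>\<mu>. if \<mu> = {#k#} then 1 else 0)"

text \<open>
  \<^const>\<open>Sum_any\<close> sums the finitely many nonzero values of a function; it is used for
  infinite sums that are finite in each coefficient: \<open>\<Sum>\<^sub>k c\<^sub>k p\<^sub>k\<close>, and \<open>\<Sum>\<^sub>n G\<^sup>n / n!\<close>
  for \<open>G\<close> without constant term.
\<close>

definition ps_linear :: "(num \<Rightarrow> 'r) \<Rightarrow> 'r::comm_ring_1 pser" where
  "ps_linear c = Abs_pser (\<lambda>\<mu>. Sum_any (\<lambda>k. ps_nth (ps_const (c k) * ps_var k) \<mu>))"

definition ps_exp :: "'r::field_char_0 pser \<Rightarrow> 'r pser" where
  "ps_exp G = Abs_pser (\<lambda>\<mu>. Sum_any (\<lambda>n. ps_nth (G ^ n) \<mu> / fact n))"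

text \<open>An inverse in a commutative ring is unique; it exists when the constant term is a unit.\<close>

definition ps_inv :: "'r::comm_ring_1 pser \<Rightarrow> 'r pser" where
  "ps_inv G = (THE H. G * H = 1)"


section \<open>Series in z\<close>

text \<open>
  The products defining the currents live in \<open>K((z\<^sup>-\<^sup>1))[[p\<^sub>1, p\<^sub>2, \<dots>]]\<close>: in each of
  the factors the coefficient of a fixed monomial in the \<open>p\<^sub>k\<close> has only finitely many positive
  powers of \<open>z\<close> (the prefactors, expanded as power series in \<open>z\<close>, have
  coefficients \<open>const * z ^ (\<Sum>\<^sub>i k\<^sub>i)\<close>, and the translations involve only
  \<open>z\<^sup>-\<^sup>1\<close>). Accordingly the variable of the type \<^typ>\<open>'k fls\<close> stands for \<open>z\<^sup>-\<^sup>1\<close>.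
\<close>

abbreviation zvar :: "'k::field fls" where
  "zvar \<equiv> fls_X_inv"

definition z_coeff :: "int \<Rightarrow> 'k::field fls pser \<Rightarrow> 'k pser" where
  "z_coeff n G = Abs_pser (\<lambda>\<mu>. fls_nth (ps_nth G \<mu>) (- n))"

text \<open>\<open>C_inf u\<close> is \<open>C\<^sub>\<infinity>(u) = exp (- \<Sum>\<^sub>k p\<^sub>k u\<^sup>k / k)\<close>, for \<open>u = c z\<close>.\<close>

definition C_inf :: "'k::field_char_0 fls \<Rightarrow> 'k fls pser" where
  "C_inf u = ps_exp (- ps_linear (\<lambda>k. u ^ nat_of_num k / of_nat (nat_of_num k)))"


section \<open>Plethysm\<close>

text \<open>
  Substitution \<open>p\<^sub>k \<mapsto> g\<^sub>k\<close>, sending \<open>F = \<Sum>\<^sub>\<mu> F\<^sub>\<mu> \<Prod>\<^bsub>k \<in> \<mu>\<^esub> p\<^sub>k\<close> to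
  \<open>\<Sum>\<^sub>\<mu> F\<^sub>\<mu> \<Prod>\<^bsub>k \<in> \<mu>\<^esub> g\<^sub>k\<close>, for \<open>g\<^sub>k\<close> in \<open>K[[p]]\<close> and in
  \<open>K((z\<^sup>-\<^sup>1))[[p]]\<close>. In the second case the sum is finite only for each
  monomial in the \<open>p\<^sub>k\<close> and each power of \<open>z\<close>.
\<close>

definition ps_subst :: "(num \<Rightarrow> 'k pser) \<Rightarrow> 'k::field pser \<Rightarrow> 'k pser" where
  "ps_subst g F = Abs_pser (\<lambda>\<nu>. Sum_any (\<lambda>\<mu>. ps_nth F \<mu> * ps_nth (\<Prod>k\<in>#\<mu>. g k) \<nu>))"

definition ps_subst_fls :: "(num \<Rightarrow> 'k fls pser) \<Rightarrow> 'k::field pser \<Rightarrow> 'k fls pser" where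
  "ps_subst_fls g F = Abs_pser (\<lambda>\<nu>. Abs_fls (\<lambda>n.
     Sum_any (\<lambda>\<mu>. ps_nth F \<mu> * fls_nth (ps_nth (\<Prod>k\<in>#\<mu>. g k) \<nu>) n)))"

text \<open>
  \<open>pleth_scale \<lambda> q t F\<close> is \<open>F[\<lambda>(q,t) X]\<close> and \<open>pleth_shift \<lambda> q t F\<close> is
  \<open>F[X + \<lambda>(q,t) / z]\<close>, with \<open>p\<^sub>k[\<lambda>(q,t) / z] = \<lambda>(q\<^sup>k,t\<^sup>k) / z\<^sup>k\<close>. The argument
  \<open>\<lambda>\<close> is a rational function, given as a function of its two arguments.
\<close>

definition pleth_scale :: "('k \<Rightarrow> 'k \<Rightarrow> 'k) \<Rightarrow> 'k \<Rightarrow> 'k \<Rightarrow> 'k::field pser \<Rightarrow> 'k pser" where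
  "pleth_scale l q t = ps_subst (\<lambda>k.
     ps_const (l (q ^ nat_of_num k) (t ^ nat_of_num k)) * ps_var k)"

definition pleth_shift :: "('k \<Rightarrow> 'k \<Rightarrow> 'k) \<Rightarrow> 'k \<Rightarrow> 'k \<Rightarrow> 'k::field pser \<Rightarrow> 'k fls pser" where
  "pleth_shift l q t = ps_subst_fls (\<lambda>k.
     ps_var k +
     ps_const (fls_const (l (q ^ nat_of_num k) (t ^ nat_of_num k)) / zvar ^ nat_of_num k))"


section \<open>Currents\<close>

text \<open>
  A current \<open>A(z) = \<Sum>\<^sub>n z\<^sup>n A\<^sub>n\<close> is the two-sided family of its modes \<open>A\<^sub>n\<close>, which are
  operators on \<open>K[[p]]\<close>. The parameters \<open>q\<close>, \<open>t\<close> are explicit arguments of all the operators,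
  so that replacing \<open>t\<close> by \<open>t\<^sup>-\<^sup>1\<close> in an operator affects neither the series it
  acts on nor anything outside the operator.
\<close>

type_synonym 'k current = "int \<Rightarrow> 'k pser \<Rightarrow> 'k pser"

definition current_scale :: "'k::field \<Rightarrow> 'k current \<Rightarrow> 'k current" where
  "current_scale c A = (\<lambda>n F. ps_const c * A n F)"

text \<open>\<open>current_rescale c A\<close> is \<open>A(c z)\<close>.\<close>

definition current_rescale :: "'k::field \<Rightarrow> 'k current \<Rightarrow> 'k current" where
  "current_rescale c A = (\<lambda>n F. ps_const (c powi n) * A n F)"

definition D :: "'k::field_char_0 \<Rightarrow> 'k \<Rightarrow> 'k current" where
  "D q t = (\<lambda>n F. z_coeff n (
     C_inf zvar * pleth_shift (\<lambda>q t. (1 - t) * (1 - q)) q t F))"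

definition D_star :: "'k::field_char_0 \<Rightarrow> 'k \<Rightarrow> 'k current" where
  "D_star q t = (\<lambda>n F. z_coeff n (
     ps_inv (C_inf zvar) *
     pleth_shift (\<lambda>q t. - ((1 - inverse t) * (1 - inverse q))) q t F))"

text \<open>
  \<open>\<mm>\<^sub>\<infinity>\<close> is the infinite-rank operator in its form written in the \<open>p\<^sub>k\<close>; replacing
  \<open>q\<close>, \<open>t\<close> by their inverses refers to this form (the limit of the rank \<open>N\<close> operators would
  not exist after \<open>t \<mapsto> t\<^sup>-\<^sup>1\<close>).
\<close>

definition m_inf :: "'k::field_char_0 \<Rightarrow> 'k \<Rightarrow> 'k current" where
  "m_inf q t = current_scale (1 / (1 - inverse t)) (\<lambda>n F. z_coeff n (
     C_inf (fls_const (inverse t) * zvar) * ps_inv (C_inf zvar) *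
     pleth_shift (\<lambda>q t. q - 1) q t F))"

text \<open>\<open>m_tilde_inf\<close> is \<open>\<mm>\<^sub>\<infinity>(q z)\<close> with \<open>q\<close>, \<open>t\<close> replaced by their inverses.\<close>

definition m_tilde_inf :: "'k::field_char_0 \<Rightarrow> 'k \<Rightarrow> 'k current" where
  "m_tilde_inf q t =
     (\<lambda>q t. current_rescale q (m_inf q t)) (inverse q) (inverse t)"

definition Sigma_op :: "'k::field \<Rightarrow> 'k \<Rightarrow> 'k pser \<Rightarrow> 'k pser" where
  "Sigma_op = pleth_scale (\<lambda>q t. 1 / (t - 1))"

definition Sigma_inv_op :: "'k::field \<Rightarrow> 'k \<Rightarrow> 'k pser \<Rightarrow> 'k pser" where
  "Sigma_inv_op = pleth_scale (\<lambda>q t. t - 1)"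

definition Sigma_conj :: "'k::field \<Rightarrow> 'k \<Rightarrow> 'k current \<Rightarrow> 'k current" where
  "Sigma_conj q t A = (\<lambda>n. Sigma_inv_op q t \<circ> A n \<circ> Sigma_op q t)"

definition at_inverse :: "('k::field \<Rightarrow> 'k current) \<Rightarrow> 'k \<Rightarrow> 'k current" where
  "at_inverse A t = A (inverse t)"


section \<open>The indeterminates\<close>

instance fract :: ("{idom, ring_char_0}") field_char_0
proof
  show "inj (of_nat :: nat \<Rightarrow> 'a fract)"
    by (rule injI) (simp add: of_nat_fract eq_fract)
qed

text \<open>The field \<open>\<kk>(q,t)\<close> is represented as the fraction field of \<open>\<kk>[q][t]\<close>.\<close>

type_synonym 'a ratfun = "'a poly poly fract"

definition q_indet :: "'a::field_char_0 ratfun" where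
  "q_indet = Fract [:[:0, 1:]:] 1"

definition t_indet :: "'a::field_char_0 ratfun" where
  "t_indet = Fract [:0, 1:] 1"

end

theory Submission
  imports Defs
begin

text \<open>
  The operator \<open>\<Sigma>\<^sup>-\<^sup>1\<close> is diagonal on monomials, hence multiplicative, and it commutes with
  taking modes in \<open>z\<close>. So conjugating a current by \<open>\<Sigma>\<close> amounts to applying a ring
  endomorphism of \<open>K((z\<^sup>-\<^sup>1))[[p]]\<close> separately to the exponential prefactor and to the
  translation. Put \<open>s = t\<^sup>-\<^sup>1\<close>. The prefactor \<open>C\<^sub>\<infinity>(z)\<close> becomes
  \<open>exp (- \<Sum>\<^sub>k (s\<^sup>k - 1) p\<^sub>k z\<^sup>k / k) = C\<^sub>\<infinity>(s z) / C\<^sub>\<infinity>(z)\<close>, and the translation by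
  \<open>\<lambda>\<^sub>k / z\<^sup>k\<close> becomes the translation by \<open>\<lambda>\<^sub>k / ((s\<^sup>k - 1) z\<^sup>k)\<close>. In the second identity
  the same endomorphism also rescales \<open>z\<close>.
\<close>

section \<open>Coefficients of products, constants, variables and linear series\<close>

lemma ps_nth_zero [simp]: "ps_nth 0 \<mu> = 0"
  by (simp add: zero_pser_def)

lemma ps_nth_one: "ps_nth 1 \<mu> = (if \<mu> = {#} then 1 else 0)"
  by (simp add: one_pser_def)

lemma ps_nth_add [simp]: "ps_nth (F + G) \<mu> = ps_nth F \<mu> + ps_nth G \<mu>"
  by (simp add: plus_pser_def)

lemma ps_nth_uminus [simp]: "ps_nth (- F) \<mu> = - ps_nth F \<mu>"
  by (simp add: uminus_pser_def)

lemma ps_nth_mult: "ps_nth (F * G) \<mu> = (\<Sum>\<alpha> | \<alpha> \<subseteq># \<mu>. ps_nth F \<alpha> * ps_nth G (\<mu> - \<alpha>))"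
  by (simp add: times_pser_def)

lemma ps_nth_sum [simp]: "ps_nth (sum f A) \<mu> = (\<Sum>x\<in>A. ps_nth (f x) \<mu>)"
  by (induction A rule: infinite_finite_induct) auto

lemma ps_nth_const: "ps_nth (ps_const c) \<mu> = (if \<mu> = {#} then c else 0)"
  by (simp add: ps_const_def)

lemma ps_nth_var: "ps_nth (ps_var k) \<mu> = (if \<mu> = {#k#} then 1 else 0)"
  by (simp add: ps_var_def)

lemma ps_nth_const_mult [simp]: "ps_nth (ps_const c * G) \<mu> = c * ps_nth G \<mu>"
proof -
  have "(\<Sum>\<alpha> | \<alpha> \<subseteq># \<mu>. ps_nth (ps_const c) \<alpha> * ps_nth G (\<mu> - \<alpha>)) =
      (\<Sum>\<alpha> | \<alpha> \<subseteq># \<mu>. if \<alpha> = {#} then c * ps_nth G \<mu> else 0)"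
    by (rule sum.cong) (auto simp: ps_nth_const)
  then show ?thesis
    by (simp add: ps_nth_mult sum.delta finite_submultisets)
qed

lemma ps_nth_var_mult:
  "ps_nth (ps_var k * G) \<mu> = (if k \<in># \<mu> then ps_nth G (\<mu> - {#k#}) else 0)"
proof -
  have "(\<Sum>\<alpha> | \<alpha> \<subseteq># \<mu>. ps_nth (ps_var k) \<alpha> * ps_nth G (\<mu> - \<alpha>)) =
      (\<Sum>\<alpha> | \<alpha> \<subseteq># \<mu>. if \<alpha> = {#k#} then ps_nth G (\<mu> - {#k#}) else 0)"
    by (rule sum.cong) (auto simp: ps_nth_var)
  then show ?thesis
    by (simp add: ps_nth_mult sum.delta finite_submultisets)
qed

lemma ps_nth_linear_singleton [simp]: "ps_nth (ps_linear c) {#k#} = c k"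
proof -
  have "Sum_any (\<lambda>j. c j * ps_nth (ps_var j) {#k#}) = sum (\<lambda>j. c j * ps_nth (ps_var j) {#k#}) {k}"
    by (rule Sum_any.expand_superset) (auto simp: ps_nth_var)
  then show ?thesis
    by (simp add: ps_linear_def ps_nth_var)
qed

lemma ps_nth_linear_eq_0: "(\<And>k. \<mu> \<noteq> {#k#}) \<Longrightarrow> ps_nth (ps_linear c) \<mu> = 0"
  by (simp add: ps_linear_def ps_nth_var)

lemma ps_linear_add: "ps_linear (\<lambda>k. c k + d k) = ps_linear c + ps_linear d"
proof (rule pser_eqI)
  fix \<mu>
  show "ps_nth (ps_linear (\<lambda>k. c k + d k)) \<mu> = ps_nth (ps_linear c + ps_linear d) \<mu>"
    by (cases "\<exists>k. \<mu> = {#k#}") (auto simp: ps_nth_linear_eq_0)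
qed

lemma ps_linear_minus: "ps_linear (\<lambda>k. - c k) = - ps_linear c"
proof (rule pser_eqI)
  fix \<mu>
  show "ps_nth (ps_linear (\<lambda>k. - c k)) \<mu> = ps_nth (- ps_linear c) \<mu>"
    by (cases "\<exists>k. \<mu> = {#k#}") (auto simp: ps_nth_linear_eq_0)
qed

section \<open>Order of vanishing and the exponential\<close>

lemma ps_nth_mult_eq_0:
  assumes F: "\<And>\<mu>. size \<mu> < i \<Longrightarrow> ps_nth F \<mu> = 0"
    and G: "\<And>\<mu>. size \<mu> < j \<Longrightarrow> ps_nth G \<mu> = 0"
    and "size \<mu> < i + j"
  shows "ps_nth (F * G) \<mu> = 0"
  unfolding ps_nth_mult
proof (rule sum.neutral, safe)
  fix \<alpha> assume "\<alpha> \<subseteq># \<mu>"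
  then have "size \<alpha> + size (\<mu> - \<alpha>) = size \<mu>"
    by (metis size_union subset_mset.add_diff_inverse)
  \<comment> \<open>The two sizes add up to less than \<open>i + j\<close>, so one factor lies below
    its order of vanishing.\<close>
  then have "size \<alpha> < i \<or> size (\<mu> - \<alpha>) < j"
    using assms(3) by linarith
  then show "ps_nth F \<alpha> * ps_nth G (\<mu> - \<alpha>) = 0"
    using F G by auto
qed

text \<open>Each factor without constant term raises the order of vanishing by one, so only finitely
  many powers meet a given monomial; this makes \<open>ps_exp\<close> a finite sum in each
  coefficient.\<close>

lemma ps_nth_power_eq_0:
  assumes "ps_nth F {#} = 0" and "size \<mu> < n"
  shows "ps_nth (F ^ n) \<mu> = 0"
  using assms(2)
proof (induction n arbitrary: \<mu>)
  case 0
  then show ?case by simp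
next
  case (Suc n)
  have "ps_nth (F * F ^ n) \<mu> = 0"
    by (rule ps_nth_mult_eq_0[where i = 1 and j = n]) (use assms(1) Suc in auto)
  then show ?case by simp
qed

text \<open>The bound \<open>N\<close> is left free so that all submultisets of one monomial can
  share the same truncation.\<close>

lemma ps_nth_exp:
  assumes "ps_nth G {#} = 0" and "size \<mu> \<le> N"
  shows "ps_nth (ps_exp G) \<mu> = (\<Sum>n\<le>N. ps_nth (G ^ n) \<mu> / fact n)"
proof -
  have "Sum_any (\<lambda>n. ps_nth (G ^ n) \<mu> / fact n) = (\<Sum>n\<le>N. ps_nth (G ^ n) \<mu> / fact n)"
  proof (rule Sum_any.expand_superset)
    show "{n. ps_nth (G ^ n) \<mu> / fact n \<noteq> 0} \<subseteq> {..N}"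
      using assms ps_nth_power_eq_0[of G \<mu>] by (force simp: not_less[symmetric])
  qed simp
  then show ?thesis by (simp add: ps_exp_def)
qed

lemma ps_exp_zero: "ps_exp 0 = 1"
proof (rule pser_eqI)
  fix \<mu>
  have "ps_nth (ps_exp 0) \<mu> = (\<Sum>n\<le>size \<mu>. ps_nth (0 ^ n) \<mu> / fact n :: 'a)"
    by (rule ps_nth_exp) auto
  also have "\<dots> = (\<Sum>n\<le>size \<mu>. if n = 0 then ps_nth 1 \<mu> else 0)"
    by (rule sum.cong) (auto simp: power_0_left)
  finally show "ps_nth (ps_exp 0) \<mu> = ps_nth (1 :: 'a pser) \<mu>"
    by simp
qed

lemma ps_exp_add:
  assumes F: "ps_nth F {#} = 0" and G: "ps_nth G {#} = 0"
  shows "ps_exp (F + G) = ps_exp F * ps_exp G"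
proof (rule pser_eqI)
  fix \<mu> :: "num multiset"
  define N where "N = size \<mu>"
  define f where "f i j = ps_nth (F ^ i * G ^ j) \<mu> / (fact i * fact j)" for i j
  have vanish: "f i j = 0" if "\<not> i + j \<le> N" for i j
    unfolding f_def
    by (subst ps_nth_mult_eq_0[where i = i and j = j])
      (use that in \<open>auto simp: F G N_def ps_nth_power_eq_0\<close>)
  have "ps_nth (ps_exp F * ps_exp G) \<mu> =
      (\<Sum>\<alpha> | \<alpha> \<subseteq># \<mu>. \<Sum>i\<le>N. \<Sum>j\<le>N.
        ps_nth (F ^ i) \<alpha> * ps_nth (G ^ j) (\<mu> - \<alpha>) / (fact i * fact j))"
    unfolding ps_nth_mult
  proof (rule sum.cong)
    fix \<alpha> assume "\<alpha> \<in> {\<alpha>. \<alpha> \<subseteq># \<mu>}"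
    then have "size \<alpha> \<le> N" "size (\<mu> - \<alpha>) \<le> N"
      by (auto simp: N_def size_mset_mono)
    then show "ps_nth (ps_exp F) \<alpha> * ps_nth (ps_exp G) (\<mu> - \<alpha>) = (\<Sum>i\<le>N. \<Sum>j\<le>N.
        ps_nth (F ^ i) \<alpha> * ps_nth (G ^ j) (\<mu> - \<alpha>) / (fact i * fact j))"
      by (simp add: ps_nth_exp[OF F] ps_nth_exp[OF G] sum_product)
  qed simp
  also have "\<dots> = (\<Sum>i\<le>N. \<Sum>j\<le>N. f i j)"
    by (subst sum.swap, rule sum.cong[OF refl], subst sum.swap)
      (simp add: f_def ps_nth_mult sum_divide_distrib)
  also have "\<dots> = (\<Sum>(i, j)\<in>{..N} \<times> {..N}. f i j)"
    by (simp add: sum.cartesian_product)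
  \<comment> \<open>By \<open>vanish\<close> the square may be cut down to a triangle; summing along
    \<open>i + j = n\<close> then gives the binomial expansion of
    \<open>(F + G) ^ n\<close>.\<close>
  also have "\<dots> = (\<Sum>(i, j)\<in>{(i, j). i + j \<le> N}. f i j)"
    by (rule sum.mono_neutral_right) (use vanish in force)+
  also have "\<dots> = (\<Sum>n\<le>N. \<Sum>i\<le>n. f i (n - i))"
    by (rule sum.triangle_reindex_eq)
  also have "\<dots> = (\<Sum>n\<le>N. ps_nth ((F + G) ^ n) \<mu> / fact n)"
  proof (rule sum.cong[OF refl])
    fix n
    have of_nat: "ps_nth (of_nat m * H) \<mu> = of_nat m * ps_nth H \<mu>" for m and H :: "'a pser"
      by (induction m) (auto simp: distrib_right)
    have "(\<Sum>i\<le>n. f i (n - i)) =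
        (\<Sum>i\<le>n. of_nat (n choose i) * ps_nth (F ^ i * G ^ (n - i)) \<mu> / fact n)"
      by (rule sum.cong[OF refl]) (simp add: f_def binomial_fact)
    then show "(\<Sum>i\<le>n. f i (n - i)) = ps_nth ((F + G) ^ n) \<mu> / fact n"
      by (simp add: binomial_ring mult.assoc of_nat sum_divide_distrib)
  qed
  also have "\<dots> = ps_nth (ps_exp (F + G)) \<mu>"
    by (rule ps_nth_exp[symmetric]) (simp_all add: F G N_def)
  finally show "ps_nth (ps_exp (F + G)) \<mu> = ps_nth (ps_exp F * ps_exp G) \<mu>" ..
qed

text \<open>The addition rule applied to \<open>G\<close> and \<open>- G\<close> produces an
  inverse, and inverses in a commutative ring are unique.\<close>

lemma ps_inv_exp:
  assumes "ps_nth G {#} = 0"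
  shows "ps_inv (ps_exp G) = ps_exp (- G)"
proof -
  have inverse: "ps_exp G * ps_exp (- G) = 1"
    using ps_exp_add[of G "- G"] assms by (simp add: ps_exp_zero)
  show ?thesis unfolding ps_inv_def
  proof (rule the_equality)
    show "ps_exp G * ps_exp (- G) = 1" by (rule inverse)
    fix H assume H: "ps_exp G * H = 1"
    have "H = (ps_exp G * ps_exp (- G)) * H" by (simp add: inverse)
    also have "\<dots> = (ps_exp G * H) * ps_exp (- G)" by (simp only: mult_ac)
    finally show "H = ps_exp (- G)" by (simp add: H)
  qed
qed

section \<open>Diagonal plethysm and dilation of z\<close>

lemma ps_nth_pleth_scale:
  "ps_nth (pleth_scale l q t F) \<mu> =
    (\<Prod>k\<in>#\<mu>. l (q ^ nat_of_num k) (t ^ nat_of_num k)) * ps_nth F \<mu>"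
proof -
  \<comment> \<open>Each monomial is an eigenvector of a diagonal substitution, so the sum over
    monomials has a single term.\<close>
  have monomial: "ps_nth (\<Prod>k\<in>#\<alpha>. ps_const (a k) * ps_var k) \<beta> =
      (if \<beta> = \<alpha> then \<Prod>k\<in>#\<alpha>. a k else 0)" for a :: "num \<Rightarrow> 'a" and \<alpha> \<beta>
    by (induction \<alpha> arbitrary: \<beta>) (auto simp: ps_nth_one ps_nth_var_mult mult.assoc)
  show ?thesis
    unfolding pleth_scale_def ps_subst_def ps_nth_Abs monomial
    by (subst Sum_any.expand_superset[of "{\<mu>}"]) (auto simp: mult.commute)
qed

text \<open>The variable of \<^typ>\<open>'k fls\<close> being \<open>z\<^sup>-\<^sup>1\<close>, \<open>fls_dilate d\<close> is \<open>z \<mapsto> z / d\<close>.\<close>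

definition fls_dilate :: "'k::field \<Rightarrow> 'k fls \<Rightarrow> 'k fls" where
  "fls_dilate d f = Abs_fls (\<lambda>n. d powi n * fls_nth f n)"

lemma fls_dilate_nth [simp]: "fls_nth (fls_dilate d f) n = d powi n * fls_nth f n"
  unfolding fls_dilate_def
  by (rule nth_Abs_fls_lower_bound[of "fls_subdegree f"]) auto

lemma fls_dilate_0 [simp]: "fls_dilate d 0 = 0"
  by (rule fls_eqI) simp

lemma fls_dilate_const [simp]: "fls_dilate d (fls_const c) = fls_const c"
  by (rule fls_eqI) simp

lemma fls_dilate_1 [simp]: "fls_dilate d 1 = 1"
  using fls_dilate_const[of d 1] by simp

lemma fls_dilate_add [simp]: "fls_dilate d (f + g) = fls_dilate d f + fls_dilate d g"
  by (rule fls_eqI) (simp add: distrib_left)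

lemma fls_dilate_uminus [simp]: "fls_dilate d (- f) = - fls_dilate d f"
  by (rule fls_eqI) simp

lemma fls_dilate_sum [simp]: "fls_dilate d (sum f A) = (\<Sum>x\<in>A. fls_dilate d (f x))"
  by (induction A rule: infinite_finite_induct) auto

lemma fls_dilate_of_nat [simp]: "fls_dilate d (of_nat n) = of_nat n"
  by (simp add: fls_of_nat)

lemma fls_dilate_X_inv: "fls_dilate d fls_X_inv = fls_const (inverse d) * fls_X_inv"
  by (rule fls_eqI) (simp add: power_int_minus)

text \<open>The weights satisfy \<open>d powi i * d powi (n - i) = d powi n\<close>. For
  \<open>d \<noteq> 0\<close> subdegrees are preserved, so both convolutions run over the same index
  range.\<close>

lemma fls_dilate_mult:
  assumes "d \<noteq> 0"
  shows "fls_dilate d (f * g) = fls_dilate d f * fls_dilate d g"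
proof -
  have subdegree: "fls_subdegree (fls_dilate d h) = fls_subdegree h" for h
  proof (cases "h = 0")
    case False
    then show ?thesis
      using assms by (intro fls_subdegree_eqI) auto
  qed simp
  have "d powi n * (fls_nth f i * fls_nth g (n - i)) =
      d powi i * fls_nth f i * (d powi (n - i) * fls_nth g (n - i))" for i n
    using assms power_int_add[of d i "n - i"] by simp
  then show ?thesis
    by (intro fls_eqI) (simp only: fls_times_nth(2) fls_dilate_nth subdegree sum_distrib_left)
qed

lemma fls_dilate_power: "d \<noteq> 0 \<Longrightarrow> fls_dilate d (f ^ n) = fls_dilate d f ^ n"
  by (induction n) (auto simp: fls_dilate_mult)

lemma fls_dilate_divide:
  assumes "d \<noteq> 0"
  shows "fls_dilate d (f / g) = fls_dilate d f / fls_dilate d g"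
proof (cases "g = 0")
  case False
  then have "fls_dilate d (f / g) * fls_dilate d g = fls_dilate d f"
    using assms by (simp flip: fls_dilate_mult)
  \<comment> \<open>Dilation is multiplicative and fixes 1, so it sends units to units.\<close>
  moreover have "fls_dilate d g \<noteq> 0"
  proof
    assume "fls_dilate d g = 0"
    moreover have "fls_dilate d g * fls_dilate d (inverse g) = 1"
      using assms False by (simp flip: fls_dilate_mult)
    ultimately show False by simp
  qed
  ultimately show ?thesis by (simp add: field_simps)
qed simp

text \<open>This is the endomorphism \<open>p\<^sub>k \<mapsto> a\<^sub>k p\<^sub>k\<close>,
  \<open>z \<mapsto> z / d\<close> for \<open>d \<noteq> 0\<close>. Being diagonal on monomials, it
  can be given on coefficients, without infinite substitutions. For \<open>d = 1\<close> it extends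
  \<open>pleth_scale\<close> to series in z.\<close>

definition ps_dilate :: "(num \<Rightarrow> 'k::field) \<Rightarrow> 'k \<Rightarrow> 'k fls pser \<Rightarrow> 'k fls pser" where
  "ps_dilate a d G = Abs_pser (\<lambda>\<mu>. fls_const (\<Prod>k\<in>#\<mu>. a k) * fls_dilate d (ps_nth G \<mu>))"

lemma ps_nth_dilate:
  "ps_nth (ps_dilate a d G) \<mu> = fls_const (\<Prod>k\<in>#\<mu>. a k) * fls_dilate d (ps_nth G \<mu>)"
  by (simp add: ps_dilate_def)

lemma ps_dilate_const: "ps_dilate a d (ps_const c) = ps_const (fls_dilate d c)"
  by (rule pser_eqI) (simp add: ps_nth_dilate ps_nth_const)

lemma ps_dilate_1: "ps_dilate a d 1 = 1"
  by (rule pser_eqI) (simp add: ps_nth_dilate ps_nth_one)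

lemma ps_dilate_var: "ps_dilate a d (ps_var k) = ps_const (fls_const (a k)) * ps_var k"
  by (rule pser_eqI) (simp add: ps_nth_dilate ps_nth_var)

lemma ps_dilate_add: "ps_dilate a d (F + G) = ps_dilate a d F + ps_dilate a d G"
  by (rule pser_eqI) (simp add: ps_nth_dilate distrib_left)

text \<open>The weight \<open>\<Prod>k\<in>#\<mu>. a k\<close> factors along
  \<open>\<mu> = \<alpha> + \<beta>\<close>, so it distributes over each term of the
  product.\<close>

lemma ps_dilate_mult:
  assumes "d \<noteq> 0"
  shows "ps_dilate a d (F * G) = ps_dilate a d F * ps_dilate a d G"
proof (rule pser_eqI)
  fix \<mu>
  have "fls_const (\<Prod>k\<in>#\<mu>. a k) * fls_dilate d (ps_nth F \<alpha> * ps_nth G (\<mu> - \<alpha>)) =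
      ps_nth (ps_dilate a d F) \<alpha> * ps_nth (ps_dilate a d G) (\<mu> - \<alpha>)" if sub: "\<alpha> \<subseteq># \<mu>" for \<alpha>
  proof -
    obtain \<beta> where "\<mu> = \<alpha> + \<beta>"
      using sub by (auto simp: mset_subset_eq_exists_conv)
    then show ?thesis
      using assms fls_const_mult_const[of "\<Prod>k\<in>#\<alpha>. a k" "\<Prod>k\<in>#\<beta>. a k"]
      by (simp add: ps_nth_dilate fls_dilate_mult mult_ac)
  qed
  then show "ps_nth (ps_dilate a d (F * G)) \<mu> = ps_nth (ps_dilate a d F * ps_dilate a d G) \<mu>"
    unfolding ps_nth_dilate[of a d "F * G"] ps_nth_mult by (simp add: sum_distrib_left)
qed

lemma ps_dilate_power: "d \<noteq> 0 \<Longrightarrow> ps_dilate a d (F ^ n) = ps_dilate a d F ^ n"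
  by (induction n) (auto simp: ps_dilate_mult ps_dilate_1)

lemma ps_dilate_prod_mset:
  "d \<noteq> 0 \<Longrightarrow> ps_dilate a d (\<Prod>k\<in>#\<mu>. g k) = (\<Prod>k\<in>#\<mu>. ps_dilate a d (g k))"
  by (induction \<mu>) (auto simp: ps_dilate_mult ps_dilate_1)

lemma ps_dilate_exp:
  assumes "d \<noteq> 0" and "ps_nth G {#} = 0"
  shows "ps_dilate a d (ps_exp G) = ps_exp (ps_dilate a d G)"
proof (rule pser_eqI)
  fix \<mu>
  have "fls_dilate d (fact n) = fact n" for n
    by (metis fls_dilate_of_nat of_nat_fact)
  then show "ps_nth (ps_dilate a d (ps_exp G)) \<mu> = ps_nth (ps_exp (ps_dilate a d G)) \<mu>"
    \<comment> \<open>The instance at \<open>{#}\<close> shows that the dilated series has no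
      constant term either, so both exponentials are truncated at the same power.\<close>
    using assms ps_nth_dilate[of a d G "{#}"]
    by (simp add: ps_nth_dilate[of a d "ps_exp G"] ps_nth_exp[OF _ order_refl] fls_dilate_divide
        sum_distrib_left ps_nth_dilate[of a d "_ ^ _"] flip: ps_dilate_power)
qed

lemma ps_dilate_linear:
  "ps_dilate a d (ps_linear c) = ps_linear (\<lambda>k. fls_const (a k) * fls_dilate d (c k))"
proof (rule pser_eqI)
  fix \<mu>
  show "ps_nth (ps_dilate a d (ps_linear c)) \<mu> =
      ps_nth (ps_linear (\<lambda>k. fls_const (a k) * fls_dilate d (c k))) \<mu>"
    by (cases "\<exists>k. \<mu> = {#k#}") (auto simp: ps_nth_linear_eq_0 ps_nth_dilate)
qed

section \<open>The prefactors as exponentials of linear series\<close>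

lemma ps_exp_linear_add:
  "ps_exp (ps_linear c) * ps_exp (ps_linear d) = ps_exp (ps_linear (\<lambda>k. c k + d k))"
  by (simp add: ps_linear_add ps_exp_add ps_nth_linear_eq_0)

lemma C_inf_eq: "C_inf u = ps_exp (ps_linear (\<lambda>k. - (u ^ nat_of_num k / of_nat (nat_of_num k))))"
  by (simp add: C_inf_def ps_linear_minus)

lemma inv_C_inf_eq:
  "ps_inv (C_inf u) = ps_exp (ps_linear (\<lambda>k. u ^ nat_of_num k / of_nat (nat_of_num k)))"
  by (simp add: C_inf_def ps_inv_exp ps_nth_linear_eq_0)

lemma ps_dilate_exp_linear:
  "d \<noteq> 0 \<Longrightarrow> ps_dilate a d (ps_exp (ps_linear c)) =
    ps_exp (ps_linear (\<lambda>k. fls_const (a k) * fls_dilate d (c k)))"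
  by (simp add: ps_dilate_exp ps_dilate_linear ps_nth_linear_eq_0)

lemma fls_dilate_zvar_power:
  "d \<noteq> 0 \<Longrightarrow> fls_dilate d (zvar ^ n) = fls_const (inverse d) ^ n * zvar ^ n"
  by (simp add: fls_dilate_power fls_dilate_X_inv power_mult_distrib)

lemma fls_const_power_minus_1: "fls_const (s ^ n - 1) = fls_const s ^ n - 1"
  for s :: "'k::field"
  by (metis fls_const_1 fls_const_power fls_minus_const)

lemma ps_dilate_C_inf:
  "ps_dilate (\<lambda>k. s ^ nat_of_num k - 1) 1 (C_inf zvar) =
    C_inf (fls_const s * zvar) * ps_inv (C_inf zvar)"
proof -
  have "fls_const (s ^ n - 1) * fls_dilate 1 (- (zvar ^ n / of_nat n)) =
      - ((fls_const s * zvar) ^ n / of_nat n) + zvar ^ n / of_nat n" for n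
    by (simp add: fls_const_power_minus_1 fls_dilate_divide fls_dilate_zvar_power
        power_mult_distrib left_diff_distrib diff_divide_distrib)
  then show ?thesis
    unfolding inv_C_inf_eq unfolding C_inf_eq
    \<comment> \<open>The minus sign stays inside \<open>fls_dilate\<close> so that the exponent
      matches the identity just computed.\<close>
    by (simp add: ps_dilate_exp_linear ps_exp_linear_add del: fls_dilate_uminus)
qed

text \<open>The dilation by \<open>s\<close> compensates the opposite sign of the exponent of
  \<open>1 / C\<^sub>\<infinity>\<close>: since \<open>(s ^ k - 1) / s ^ k = 1 - 1 / s ^ k\<close>,
  the numerator again comes from the term with the minus sign, now at \<open>z / s\<close>.\<close>

lemma ps_dilate_inv_C_inf:
  assumes "s \<noteq> 0"
  shows "ps_dilate (\<lambda>k. s ^ nat_of_num k - 1) s (ps_inv (C_inf zvar)) =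
    C_inf (fls_const (inverse s) * zvar) * ps_inv (C_inf zvar)"
proof -
  have "fls_const s * fls_const (inverse s) = 1"
    using assms by simp
  then have unit: "fls_const s ^ n * fls_const (inverse s) ^ n = 1" for n
    by (metis power_mult_distrib power_one)
  have "fls_const (s ^ n - 1) * fls_dilate s (zvar ^ n / of_nat n) =
      - ((fls_const (inverse s) * zvar) ^ n / of_nat n) + zvar ^ n / of_nat n" for n
    using assms unit[of n]
    by (simp add: fls_const_power_minus_1 fls_dilate_divide fls_dilate_zvar_power
        power_mult_distrib left_diff_distrib diff_divide_distrib flip: mult.assoc)
  then show ?thesis
    using assms unfolding inv_C_inf_eq unfolding C_inf_eq
    by (simp add: ps_dilate_exp_linear ps_exp_linear_add)
qed

section \<open>The translation under the endomorphism\<close>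

lemma ps_nth_subst_fls:
  assumes "\<And>k \<nu> n. n < 0 \<Longrightarrow> fls_nth (ps_nth (g k) \<nu>) n = 0"
  shows "fls_nth (ps_nth (ps_subst_fls g F) \<nu>) n =
    Sum_any (\<lambda>\<mu>. ps_nth F \<mu> * fls_nth (ps_nth (\<Prod>k\<in>#\<mu>. g k) \<nu>) n)"
proof -
  \<comment> \<open>\<open>Abs_fls\<close> returns the intended coefficients only if they vanish
    below some bound. Series in \<open>z\<^sup>-\<^sup>1\<close> supported in nonnegative degrees
    are closed under products, so 0 is a bound for all monomials at once.\<close>
  have mult: "fls_nth (f * h) n = 0"
    if f: "\<And>n. n < 0 \<Longrightarrow> fls_nth f n = 0" and h: "\<And>n. n < 0 \<Longrightarrow> fls_nth h n = 0" and "n < 0"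
    for f h :: "'a fls" and n
  proof -
    have "fls_subdegree f \<ge> 0" "fls_subdegree h \<ge> 0"
      using f h by (metis fls_subdegree_geI fls_zero_subdegree order_refl)+
    then show ?thesis
      using \<open>n < 0\<close> by (intro fls_times_nth_eq0) linarith
  qed
  have "fls_nth (ps_nth (\<Prod>k\<in>#\<mu>. g k) \<nu>) n = 0" if "n < 0" for \<mu> \<nu> n
    using that
  proof (induction \<mu> arbitrary: \<nu> n)
    case empty
    then show ?case by (simp add: ps_nth_one)
  next
    case (add k \<mu>)
    then show ?case
      by (auto simp: ps_nth_mult fls_nth_sum intro!: sum.neutral mult assms)
  qed
  then show ?thesis
    unfolding ps_subst_fls_def ps_nth_Abs by (intro nth_Abs_fls_lower_bound[of 0]) auto
qed

text \<open>For \<open>c \<noteq> 0\<close> the two supports coincide; if they are infinite, both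
  sums take the default value 0.\<close>

lemma Sum_any_mult_left: "Sum_any (\<lambda>x. c * f x) = c * Sum_any f" for c :: "'b::field"
  by (cases "c = 0") (simp_all add: Sum_any.expand_set sum_distrib_left)

text \<open>With \<open>m\<^sub>k\<close>, \<open>l\<^sub>k\<close>, \<open>l'\<^sub>k\<close> the
  values at the k-th powers, the composite sends \<open>p\<^sub>k\<close> to \<open>m\<^sub>k
  (a\<^sub>k p\<^sub>k + l\<^sub>k d\<^sup>k / z\<^sup>k)\<close>. Assumption \<open>unit\<close>
  turns the first term into \<open>p\<^sub>k\<close>, and \<open>shift\<close> the second into
  \<open>l'\<^sub>k / z\<^sup>k\<close>.\<close>

lemma ps_dilate_pleth_shift:
  assumes "d \<noteq> 0"
    and unit: "\<And>k. a k * m (q ^ nat_of_num k) (s ^ nat_of_num k) = 1"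
    and shift: "\<And>k. m (q ^ nat_of_num k) (s ^ nat_of_num k) * l (q ^ nat_of_num k) (s ^ nat_of_num k) *
        d ^ nat_of_num k = l' (q' ^ nat_of_num k) (s' ^ nat_of_num k)"
  shows "ps_dilate a d (pleth_shift l q s (pleth_scale m q s F)) = pleth_shift l' q' s' F"
proof -
  define b where "b k = m (q ^ nat_of_num k) (s ^ nat_of_num k)" for k
  define g :: "('a \<Rightarrow> 'a \<Rightarrow> 'a) \<Rightarrow> 'a \<Rightarrow> 'a \<Rightarrow> num \<Rightarrow> 'a fls pser"
    where "g l q s k = ps_var k +
    ps_const (fls_const (l (q ^ nat_of_num k) (s ^ nat_of_num k)) / zvar ^ nat_of_num k)"
    for l q s k
  \<comment> \<open>Dividing by \<open>zvar ^ j\<close> multiplies by \<open>fls_X ^ j\<close>, so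
    no negative index occurs.\<close>
  have nonneg: "fls_nth (ps_nth (g l q s k) \<nu>) n = 0" if "n < 0" for l q s k \<nu> n
  proof -
    have "c / zvar ^ j = c * fls_X ^ j" for c :: "'a fls" and j
      by (simp add: divide_inverse fls_inverse_X_inv_power)
    then show ?thesis
      using that by (simp add: g_def ps_nth_var ps_nth_const)
  qed
  have g: "ps_const (fls_const (b k)) * ps_dilate a d (g l q s k) = g l' q' s' k" for k
  proof (rule pser_eqI)
    fix \<nu>
    let ?n = "nat_of_num k"
    have "fls_const (b k) * (fls_const (a k) * x) = x" for x
      using unit[of k] by (simp add: b_def mult.commute flip: mult.assoc)
    moreover have "fls_const (b k) *
        fls_dilate d (fls_const (l (q ^ ?n) (s ^ ?n)) / zvar ^ ?n) =
        fls_const (l' (q' ^ ?n) (s' ^ ?n)) / zvar ^ ?n"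
      unfolding shift[symmetric] b_def
      by (intro fls_eqI) (auto simp: divide_inverse fls_inverse_X_inv_power)
    ultimately show "ps_nth (ps_const (fls_const (b k)) * ps_dilate a d (g l q s k)) \<nu> =
        ps_nth (g l' q' s' k) \<nu>"
      unfolding g_def
      by (cases "\<nu> = {#}") (simp_all only: ps_dilate_add ps_dilate_var ps_dilate_const
          ps_nth_const_mult ps_nth_add ps_nth_const distrib_left simp_thms if_True if_False
          mult_zero_right)
  qed
  have prod: "fls_const (\<Prod>k\<in>#\<mu>. b k) * ps_nth (ps_dilate a d (\<Prod>k\<in>#\<mu>. g l q s k)) \<nu> =
      ps_nth (\<Prod>k\<in>#\<mu>. g l' q' s' k) \<nu>" for \<mu> \<nu>
  proof -
    have const: "ps_const (fls_const (\<Prod>k\<in>#\<mu>. b k)) = (\<Prod>k\<in>#\<mu>. ps_const (fls_const (b k)))"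
    proof (induction \<mu>)
      case empty
      then show ?case by (auto intro: pser_eqI simp: ps_nth_const ps_nth_one)
    next
      case (add k \<mu>)
      then show ?case
        by (auto intro!: pser_eqI simp: ps_nth_const simp flip: add fls_const_mult_const)
    qed
    show ?thesis
      unfolding g[symmetric] prod_mset.distrib const[symmetric]
      using assms(1) by (simp add: ps_dilate_prod_mset)
  qed
  show ?thesis
  \<comment> \<open>The two infinite sums agree term by term: the factor from
    \<open>pleth_scale\<close> moves inside and is absorbed by \<open>prod\<close>.\<close>
  proof (intro pser_eqI fls_eqI)
    fix \<nu> n
    have "fls_nth (ps_nth (ps_dilate a d (pleth_shift l q s (pleth_scale m q s F))) \<nu>) n =
        Sum_any (\<lambda>\<mu>. ps_nth F \<mu> * fls_nth (fls_const (\<Prod>k\<in>#\<mu>. b k) *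
          ps_nth (ps_dilate a d (\<Prod>k\<in>#\<mu>. g l q s k)) \<nu>) n)"
      unfolding pleth_shift_def g_def[symmetric]
      by (simp add: ps_nth_dilate ps_nth_subst_fls nonneg ps_nth_pleth_scale b_def mult_ac
          flip: Sum_any_mult_left)
    then show "fls_nth (ps_nth (ps_dilate a d (pleth_shift l q s (pleth_scale m q s F))) \<nu>) n =
        fls_nth (ps_nth (pleth_shift l' q' s' F) \<nu>) n"
      unfolding prod unfolding pleth_shift_def g_def[symmetric]
      by (simp add: ps_nth_subst_fls nonneg)
  qed
qed

section \<open>Conjugation of the currents\<close>

lemma z_coeff_ps_dilate:
  "ps_nth (z_coeff n (ps_dilate a d G)) \<mu> =
    (\<Prod>k\<in>#\<mu>. a k) * (d powi (- n) * ps_nth (z_coeff n G) \<mu>)"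
  \<comment> \<open>Mode \<open>n\<close> in z sits at index \<open>- n\<close> of the series in
    \<open>z\<^sup>-\<^sup>1\<close>, hence the exponent of \<open>d\<close>; the product over
    \<open>\<mu>\<close> becomes the eigenvalue of \<open>Sigma_inv_op\<close>.\<close>
  by (simp add: z_coeff_def ps_nth_dilate)

text \<open>That \<open>t\<close> is not a root of unity makes every \<open>s ^ k - 1\<close> with
  \<open>s = inverse t\<close> invertible, so scaling by \<open>1 / (s ^ k - 1)\<close> is undone by
  \<open>a\<close>.\<close>

lemma conjugated_currents:
  fixes q t :: "'a::field_char_0"
  assumes "q \<noteq> 0" and "t \<noteq> 0" and "\<And>n. n > 0 \<Longrightarrow> t ^ n \<noteq> 1"
  shows "m_inf q t =
           current_scale (1 / (1 - inverse t))
             (at_inverse (\<lambda>t. Sigma_conj q t (D q t)) t) \<and>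
         m_tilde_inf q t =
           current_scale (1 / (1 - t))
             (at_inverse (\<lambda>t. Sigma_conj q t (current_rescale (1 / (q * t)) (D_star q t))) t)"
proof
  define s where "s = inverse t"
  define a where "a k = s ^ nat_of_num k - 1" for k
  have nz: "s \<noteq> 0"
    using assms by (simp add: s_def)
  have s_power: "s ^ nat_of_num k \<noteq> 1" for k
    using assms(3)[OF nat_of_num_pos] by (simp add: s_def power_inverse)

  \<comment> \<open>Here \<open>x = s ^ k\<close> and \<open>y = q ^ k\<close>: the denominator from
    \<open>Sigma_op\<close> cancels the factor in \<open>x\<close>. In \<open>shift_D_star\<close>
    the extra \<open>x\<close> comes from the dilation by \<open>s\<close>.\<close>
  have shift_D: "(1 - x) * (1 - y) / (x - 1) = y - 1" if "x \<noteq> 1" for x y :: 'a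
    using that by (simp add: field_simps)
  have shift_D_star: "(1 - inverse x) * (1 - inverse y) * x / (x - 1) = 1 - inverse y"
    if "x \<noteq> 0" "x \<noteq> 1" for x y :: 'a
    using that by (simp add: divide_simps)

  have "z_coeff n (C_inf (fls_const s * zvar) * ps_inv (C_inf zvar) *
      pleth_shift (\<lambda>q t. q - 1) q t F) = Sigma_conj q s (D q s) n F" for n F
  proof -
    have "ps_dilate a 1 (pleth_shift (\<lambda>q t. (1 - t) * (1 - q)) q s (Sigma_op q s F)) =
        pleth_shift (\<lambda>q t. q - 1) q t F"
      unfolding Sigma_op_def
      by (rule ps_dilate_pleth_shift) (use s_power in \<open>simp_all add: a_def shift_D\<close>)
    then have "C_inf (fls_const s * zvar) * ps_inv (C_inf zvar) * pleth_shift (\<lambda>q t. q - 1) q t F =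
        ps_dilate a 1 (C_inf zvar *
          pleth_shift (\<lambda>q t. (1 - t) * (1 - q)) q s (Sigma_op q s F))"
      by (simp add: ps_dilate_mult ps_dilate_C_inf a_def[abs_def])
    then show ?thesis
      by (intro pser_eqI) (simp add: z_coeff_ps_dilate Sigma_conj_def Sigma_inv_op_def
          ps_nth_pleth_scale D_def a_def)
  qed
  then show "m_inf q t = current_scale (1 / (1 - inverse t))
      (at_inverse (\<lambda>t. Sigma_conj q t (D q t)) t)"
    by (simp add: m_inf_def at_inverse_def s_def)

  \<comment> \<open>At inverted parameters the numerator of the prefactor has argument
    \<open>inverse s * z = t * z\<close>; the scalar \<open>c\<close> will be
    \<open>1 / (1 - t)\<close>.\<close>
  have "ps_const (inverse q powi n) * (ps_const c *
        z_coeff n (C_inf (fls_const t * zvar) * ps_inv (C_inf zvar) *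
          pleth_shift (\<lambda>q t. q - 1) (inverse q) s F)) =
      ps_const c * Sigma_conj q s (current_rescale (1 / (q * s)) (D_star q s)) n F" for n F c
  proof -
    let ?G = "ps_inv (C_inf zvar) *
      pleth_shift (\<lambda>q t. - ((1 - inverse t) * (1 - inverse q))) q s (Sigma_op q s F)"
    have "ps_dilate a s
        (pleth_shift (\<lambda>q t. - ((1 - inverse t) * (1 - inverse q))) q s (Sigma_op q s F)) =
        pleth_shift (\<lambda>q t. q - 1) (inverse q) s F"
      unfolding Sigma_op_def
      by (rule ps_dilate_pleth_shift)
        (use s_power nz in \<open>simp_all add: a_def power_inverse shift_D_star\<close>)
    then have dilate: "C_inf (fls_const t * zvar) * ps_inv (C_inf zvar) *
        pleth_shift (\<lambda>q t. q - 1) (inverse q) s F = ps_dilate a s ?G"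
      using nz ps_dilate_inv_C_inf[of s] by (simp add: ps_dilate_mult a_def[abs_def] s_def)
    \<comment> \<open>The rescaling splits in two: \<open>s powi (- n)\<close> is the mode factor of
      the dilation by \<open>s\<close>, and \<open>inverse q powi n\<close> is the rescaling in
      \<open>m_tilde_inf\<close>.\<close>
    have "(1 / (q * s)) powi n = inverse q powi n * s powi (- n)"
      by (simp add: divide_inverse power_int_mult_distrib power_int_inverse power_int_minus)
    then show ?thesis
      unfolding dilate
      by (intro pser_eqI) (simp add: z_coeff_ps_dilate Sigma_conj_def Sigma_inv_op_def
          ps_nth_pleth_scale D_star_def current_rescale_def a_def mult_ac)
  qed
  then show "m_tilde_inf q t = current_scale (1 / (1 - t))
      (at_inverse (\<lambda>t. Sigma_conj q t (current_rescale (1 / (q * t)) (D_star q t))) t)"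
    by (simp add: m_tilde_inf_def m_inf_def current_rescale_def[of "inverse q"] current_scale_def
        at_inverse_def s_def)
qed

section \<open>Specialization to the indeterminates\<close>

lemma t_indet_power_neq_1:
  assumes "n > 0"
  shows "(t_indet :: 'a::field_char_0 ratfun) ^ n \<noteq> 1"
proof
  have "(t_indet :: 'a ratfun) ^ n = Fract ([:0, 1:] ^ n) 1"
    by (induction n) (auto simp: t_indet_def One_fract_def)
  also assume "t_indet ^ n = (1 :: 'a ratfun)"
  \<comment> \<open>Polynomials embed into their fraction field, and the n-th power of the variable
    has degree \<open>n > 0\<close>, unlike 1.\<close>
  finally have "[:0, 1:] ^ n = (1 :: 'a poly poly)"
    by (simp add: One_fract_def eq_fract)
  then have "degree ([:0, 1 :: 'a poly:] ^ n) = 0" by simp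
  then show False
    using assms by (simp add: degree_power_eq)
qed

theorem theorem4p7:
  fixes q t :: "'a::field_char_0 ratfun"
  assumes "q = q_indet" and "t = t_indet"
  shows "m_inf q t =
           current_scale (1 / (1 - inverse t))
             (at_inverse (\<lambda>t. Sigma_conj q t (D q t)) t) \<and>
         m_tilde_inf q t =
           current_scale (1 / (1 - t))
             (at_inverse (\<lambda>t. Sigma_conj q t (current_rescale (1 / (q * t)) (D_star q t))) t)"
  by (rule conjugated_currents)
    (auto simp: assms t_indet_power_neq_1, auto simp: q_indet_def t_indet_def Zero_fract_def eq_fract)

end
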